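(* Let $1<p<\infty$, let $v$ be a weight function on $\mathbb{R}^2$, and let $\phi\in L^1(\mathbb{R}^2)$. If the operator $\mathscr{H}_{\alpha,\phi}:L^p_v(\mathbb{R}^2)\to L^p_v(\mathbb{R}^2)$ is bounded, then its operator norm satisfies $$\|\mathscr{H}_{\alpha,\phi}\|\ \ge\ \int_{\mathbb{R}^2} \frac{|\phi(t_1,t_2)|}{|t_1t_2|^{2\alpha+2-\frac1p}}\left(\inf_{(y_1,y_2)\in\mathbb{R}^2}\frac{v(t_1y_1,t_2y_2)}{v(y_1,y_2)}\right)^{1/p}dt_1dt_2=:\mathscr{A}_{\inf} .$$
   Context: A weight function is a function which is measurable, positive and finite almost everywhere on its domain. $L^p_v(\mathbb{R}^2)$ is the weighted Lebesgue space with norm $\|f\|_{L^p_v(\mathbb{R}^2)}=\left(\int_{\mathbb{R}^2}|f(x_1,x_2)|^p v(x_1,x_2)\,dx_1dx_2\right)^{1/p}$. For a real parameter $\alpha$ and $\phi\in L^1(\mathbb{R}^2)$, the two dimensional Dunkl-Hausdorff operator is $$\mathscr{H}_{\alpha,\phi}f(x_1,x_2)=\int_{\mathbb{R}^2}\frac{|\phi(t_1,t_2)|}{|t_1t_2|^{2\alpha+2}}f\left(\frac{x_1}{t_1},\frac{x_2}{t_2}\right)dt_1dt_2 ,$$ and $\|\mathscr{H}_{\alpha,\phi}\|$ denotes its operator norm from $L^p_v(\mathbb{R}^2)$ to $L^p_v(\mathbb{R}^2)$. *)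

theory Defs
  imports "HOL-Analysis.Analysis"
begin

definition weight_function :: "(real \<times> real \<Rightarrow> ennreal) \<Rightarrow> bool" where
  "weight_function v \<longleftrightarrow>
     v \<in> borel_measurable lebesgue \<and> (AE x in lebesgue. 0 < v x \<and> v x < \<infinity>)"

text \<open>Scalars are an arbitrary type \<open>'a\<close> of class \<^class>\<open>real_normed_field\<close> and \<^class>\<open>banach\<close>, so
  that real- and complex-valued functions are both covered.\<close>

definition weighted_integral ::
    "real \<Rightarrow> (real \<times> real \<Rightarrow> ennreal) \<Rightarrow> (real \<times> real \<Rightarrow> 'a::real_normed_field) \<Rightarrow> ennreal" where
  "weighted_integral p v f = (\<integral>\<^sup>+ x. ennreal (norm (f x) powr p) * v x \<partial>lebesgue)"

definition Lp_space ::
    "real \<Rightarrow> (real \<times> real \<Rightarrow> ennreal) \<Rightarrow> (real \<times> real \<Rightarrow> 'a::real_normed_field) set" where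
  "Lp_space p v = {f \<in> borel_measurable lebesgue. weighted_integral p v f < \<infinity>}"

definition Lp_norm ::
    "real \<Rightarrow> (real \<times> real \<Rightarrow> ennreal) \<Rightarrow> (real \<times> real \<Rightarrow> 'a::real_normed_field) \<Rightarrow> real" where
  "Lp_norm p v f = enn2real (weighted_integral p v f) powr (1 / p)"

definition dunkl_hausdorff_integrand ::
    "real \<Rightarrow> (real \<times> real \<Rightarrow> 'a) \<Rightarrow> (real \<times> real \<Rightarrow> 'a) \<Rightarrow> real \<times> real \<Rightarrow> real \<times> real
      \<Rightarrow> 'a::real_normed_field" where
  "dunkl_hausdorff_integrand \<alpha> \<phi> f x t =
     (norm (\<phi> t) / \<bar>fst t * snd t\<bar> powr (2 * \<alpha> + 2)) *\<^sub>R f (fst x / fst t, snd x / snd t)"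

definition dunkl_hausdorff ::
    "real \<Rightarrow> (real \<times> real \<Rightarrow> 'a) \<Rightarrow> (real \<times> real \<Rightarrow> 'a) \<Rightarrow> real \<times> real
      \<Rightarrow> 'a::{real_normed_field, banach, second_countable_topology}" where
  "dunkl_hausdorff \<alpha> \<phi> f x = (\<integral> t. dunkl_hausdorff_integrand \<alpha> \<phi> f x t \<partial>lebesgue)"

text \<open>The Bochner integral of a non-integrable function is \<open>0\<close> by convention, so that the operator is
  really defined on the weighted space has to be required separately.\<close>

definition dunkl_hausdorff_defined_on ::
    "real \<Rightarrow> (real \<times> real \<Rightarrow> 'a) \<Rightarrow>
      (real \<times> real \<Rightarrow> 'a::{real_normed_field, banach, second_countable_topology}) set \<Rightarrow> bool" where
  "dunkl_hausdorff_defined_on \<alpha> \<phi> S \<longleftrightarrow>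
     (\<forall>f\<in>S. AE x in lebesgue. integrable lebesgue (dunkl_hausdorff_integrand \<alpha> \<phi> f x))"

definition operator_bounds ::
    "real \<Rightarrow> (real \<times> real \<Rightarrow> ennreal) \<Rightarrow>
      ((real \<times> real \<Rightarrow> 'a::real_normed_field) \<Rightarrow> real \<times> real \<Rightarrow> 'a) \<Rightarrow> real set" where
  "operator_bounds p v T =
     {C. 0 \<le> C \<and> (\<forall>f\<in>Lp_space p v. Lp_norm p v (T f) \<le> C * Lp_norm p v f)}"

definition bounded_operator ::
    "real \<Rightarrow> (real \<times> real \<Rightarrow> ennreal) \<Rightarrow>
      ((real \<times> real \<Rightarrow> 'a::real_normed_field) \<Rightarrow> real \<times> real \<Rightarrow> 'a) \<Rightarrow> bool" where
  "bounded_operator p v T \<longleftrightarrow>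
     (\<forall>f\<in>Lp_space p v. T f \<in> Lp_space p v) \<and> operator_bounds p v T \<noteq> {}"

definition operator_norm ::
    "real \<Rightarrow> (real \<times> real \<Rightarrow> ennreal) \<Rightarrow>
      ((real \<times> real \<Rightarrow> 'a::real_normed_field) \<Rightarrow> real \<times> real \<Rightarrow> 'a) \<Rightarrow> real" where
  "operator_norm p v T = Inf (operator_bounds p v T)"

definition ennreal_powr :: "ennreal \<Rightarrow> real \<Rightarrow> ennreal" where
  "ennreal_powr a r = (if a = \<infinity> then \<infinity> else ennreal (enn2real a powr r))"

text \<open>A weight may vanish or be infinite on a null set, where \<open>v (t y) / v y\<close> has no meaning (for
  \<^typ>\<open>ennreal\<close>, both \<open>0 / 0\<close> and \<open>\<infinity> / \<infinity>\<close> are \<open>0\<close>, which would make the infimum vanish for every non-constant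
  power weight). The infimum therefore ranges over those \<open>y\<close> for which the denominator is a positive
  real number. It is the pointwise infimum, not the essential one.\<close>

definition weight_ratio_inf :: "(real \<times> real \<Rightarrow> ennreal) \<Rightarrow> real \<times> real \<Rightarrow> ennreal" where
  "weight_ratio_inf v t =
     (INF y \<in> {y. 0 < v y \<and> v y < \<infinity>}. v (fst t * fst y, snd t * snd y) / v y)"

text \<open>The pointwise infimum need not be measurable in \<open>t\<close>; in that case \<^const>\<open>nn_integral\<close> is the
  lower integral.\<close>

definition A_inf ::
    "real \<Rightarrow> real \<Rightarrow> (real \<times> real \<Rightarrow> ennreal) \<Rightarrow> (real \<times> real \<Rightarrow> 'a::real_normed_field) \<Rightarrow> ennreal"
  where
  "A_inf p \<alpha> v \<phi> =
     (\<integral>\<^sup>+ t. ennreal (norm (\<phi> t) / \<bar>fst t * snd t\<bar> powr (2 * \<alpha> + 2 - 1 / p))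
            * ennreal_powr (weight_ratio_inf v t) (1 / p) \<partial>lebesgue)"

end

theory Submission
  imports Defs
begin

text \<open>The operator is a convolution with a positive kernel on the multiplicative group
  \<open>(\<real> - {0})\<^sup>2\<close>, whose Haar measure is \<open>dx / \<bar>x\<^sub>1 x\<^sub>2\<bar>\<close>. This group is amenable, and on an
  amenable group the norm of such a convolution on \<open>L\<^sup>p\<close> of the Haar measure is the total mass of
  the kernel. After the passage from the weighted Lebesgue measure to the Haar measure, the
  integrand of \<^const>\<open>A_inf\<close> is a lower bound for the kernel.

  In detail, insert \<open>f x = \<bar>x\<^sub>1 x\<^sub>2\<bar> powr (-1/p) * v x powr (-1/p) * G x\<close> into the operator. With
  \<open>y = x / t\<close>, so that \<open>v (t y) / v y = v x / v y\<close>, the definition of the infimum gives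
  \<open>v y powr (-1/p) \<ge> v x powr (-1/p) * weight_ratio_inf v t powr (1/p)\<close>. Hence the weight disappears: for
  \<open>G \<ge> 0\<close> and almost every \<open>x\<close>, \<open>norm (H f x) powr p * v x\<close> is at least \<open>(\<integral> h t * G (x / t) dt) powr p / \<bar>x\<^sub>1 x\<^sub>2\<bar>\<close> for each
  measurable \<open>h\<close> below the integrand of \<^const>\<open>A_inf\<close>
  (lemma \<open>dunkl_hausdorff_kernel_lower_bound\<close>).

  For \<open>G\<close> take the indicator of a box \<open>log_box N\<close> that is large in logarithmic coordinates; such
  boxes form a Foelner sequence. If \<open>h\<close> vanishes outside \<open>log_box R\<close> and \<open>N = R * M\<close>,
  then \<open>G (x / t) = 1\<close> whenever \<open>x\<close> lies in \<open>log_box M\<close> and \<open>t\<close> in the support of \<open>h\<close>. So for every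
  bound \<open>C\<close> of the operator and every real \<open>c \<le> \<integral> h\<close> the Haar measures \<open>(4 * ln M)\<^sup>2\<close> and
  \<open>(4 * ln (R * M))\<^sup>2\<close> of the two boxes satisfy
  \<open>c powr p * (4 * ln M)\<^sup>2 \<le> C powr p * (4 * ln (R * M))\<^sup>2\<close>
  (lemma \<open>dunkl_hausdorff_log_box_inequality\<close>). As \<open>M\<close> tends to infinity the ratio of the two
  measures tends to \<open>1\<close>, whence \<open>c \<le> C\<close>. Letting \<open>h\<close> and \<open>R\<close> vary, the integrals \<open>\<integral> h\<close> exhaust
  \<^const>\<open>A_inf\<close>.\<close>

section \<open>Boxes in the multiplicative group and their Haar measure\<close>

text \<open>In the coordinates \<open>ln \<bar>x\<^sub>i\<bar>\<close> this is the square with half side \<open>ln R\<close> about the origin, repeated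
  in each quadrant. It has to contain all four quadrants because the signs of \<open>t\<close> are
  arbitrary and division by \<open>t\<close> permutes the quadrants.\<close>

definition log_box :: "real \<Rightarrow> (real \<times> real) set" where
  "log_box R = {x. 1 / R \<le> \<bar>fst x\<bar> \<and> \<bar>fst x\<bar> \<le> R \<and> 1 / R \<le> \<bar>snd x\<bar> \<and> \<bar>snd x\<bar> \<le> R}"

lemma log_box_borel [measurable]: "log_box R \<in> sets borel"
proof -
  have "closed (log_box R)"
    unfolding log_box_def by (intro closed_Collect_conj closed_Collect_le continuous_intros)
  then show ?thesis by (rule borel_closed)
qed

lemma log_box_lebesgue [measurable]: "log_box R \<in> sets lebesgue"
  by (rule sets_completionI_sets) simp

lemma coordinates_lebesgue_measurable [measurable]:
  "(fst :: real \<times> real \<Rightarrow> real) \<in> borel_measurable lebesgue"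
  "(snd :: real \<times> real \<Rightarrow> real) \<in> borel_measurable lebesgue"
  by (rule measurable_completion, simp, intro borel_measurable_continuous_onI continuous_intros)+

lemma log_box_nonzero:
  assumes "1 \<le> R" "x \<in> log_box R"
  shows "fst x \<noteq> 0" "snd x \<noteq> 0"
proof -
  have "0 < 1 / R" using assms(1) by simp
  with assms(2) show "fst x \<noteq> 0" "snd x \<noteq> 0" by (auto simp: log_box_def)
qed

lemma log_box_divide:
  assumes "1 \<le> R" "0 < M" "x \<in> log_box M" "t \<in> log_box R"
  shows "(fst x / fst t, snd x / snd t) \<in> log_box (R * M)"
proof -
  have *: "1 / (R * M) \<le> \<bar>a / b\<bar> \<and> \<bar>a / b\<bar> \<le> R * M"
    if "1 / M \<le> \<bar>a\<bar>" "\<bar>a\<bar> \<le> M" "1 / R \<le> \<bar>b\<bar>" "\<bar>b\<bar> \<le> R" for a b :: real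
  proof -
    have R: "0 < R" using assms(1) by simp
    have b: "0 < \<bar>b\<bar>" using R that(3) by (smt (verit) divide_pos_pos)
    have "(1 / M) / R \<le> \<bar>a\<bar> / \<bar>b\<bar>"
      using that b assms(2) by (intro frac_le) auto
    moreover have "\<bar>a\<bar> / \<bar>b\<bar> \<le> M / (1 / R)"
      using that R by (intro frac_le) auto
    ultimately show ?thesis by (simp add: mult.commute)
  qed
  show ?thesis using assms(3,4) * by (simp add: log_box_def)
qed

lemma nn_integral_symmetric_log_interval:
  assumes "1 \<le> R"
  shows "(\<integral>\<^sup>+ x. ennreal (1 / \<bar>x\<bar>) * indicator {x. 1 / R \<le> \<bar>x\<bar> \<and> \<bar>x\<bar> \<le> R} x \<partial>lborel)
    = ennreal (4 * ln R)"
proof -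
  let ?g = "\<lambda>x::real. ennreal (1 / x) * indicator {1 / R..R} x"
  have R: "0 < 1 / R" "1 / R \<le> R" using assms by (auto simp: field_simps intro: order_trans)
  have pos: "(\<integral>\<^sup>+ x. ?g x \<partial>lborel) = ennreal (2 * ln R)"
  proof -
    have "(\<integral>\<^sup>+ x. ?g x \<partial>lborel) = ennreal (ln R - ln (1 / R))"
    proof (rule nn_integral_FTC_Icc)
      fix x assume "x \<in> {1 / R..R}"
      then have "0 < x" using R(1) by (meson atLeastAtMost_iff less_le_trans)
      then show "(ln has_real_derivative 1 / x) (at x)"
        by (auto intro!: derivative_eq_intros)
      show "0 \<le> 1 / x" using \<open>0 < x\<close> by simp
    qed (use R in auto)
    then show ?thesis using assms by (simp add: ln_div)
  qed
  have neg: "(\<integral>\<^sup>+ x. ?g (- x) \<partial>lborel) = ennreal (2 * ln R)"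
    using nn_integral_real_affine[of ?g "-1" 0] pos by simp
  have "ennreal (1 / \<bar>x\<bar>) * indicator {x. 1 / R \<le> \<bar>x\<bar> \<and> \<bar>x\<bar> \<le> R} x = ?g x + ?g (- x)" for x
  proof (cases "0 < x")
    case False
    then have "\<not> 1 / R \<le> x" using R(1) by linarith
    with False show ?thesis by (auto simp: indicator_def)
  next
    case True
    then have "\<not> 1 / R \<le> - x" using R(1) by linarith
    with True show ?thesis by (auto simp: indicator_def)
  qed
  then have "(\<integral>\<^sup>+ x. ennreal (1 / \<bar>x\<bar>) * indicator {x. 1 / R \<le> \<bar>x\<bar> \<and> \<bar>x\<bar> \<le> R} x \<partial>lborel)
      = (\<integral>\<^sup>+ x. ?g x \<partial>lborel) + (\<integral>\<^sup>+ x. ?g (- x) \<partial>lborel)"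
    by (simp add: nn_integral_add)
  then show ?thesis
    unfolding pos neg using assms by (simp flip: ennreal_plus)
qed

text \<open>The Haar measure of the box. It grows like a power of \<open>ln R\<close>, so enlarging \<open>R\<close> by a constant
  factor does not change it to first order; this is what makes the boxes a Foelner sequence.\<close>

lemma nn_integral_log_box:
  assumes "1 \<le> R"
  shows "(\<integral>\<^sup>+ x. ennreal (1 / \<bar>fst x * snd x\<bar>) * indicator (log_box R) x \<partial>lebesgue)
    = ennreal ((4 * ln R)\<^sup>2)"
proof -
  let ?g = "\<lambda>x::real. ennreal (1 / \<bar>x\<bar>) * indicator {x. 1 / R \<le> \<bar>x\<bar> \<and> \<bar>x\<bar> \<le> R} x"
  have "(\<integral>\<^sup>+ x. ennreal (1 / \<bar>fst x * snd x\<bar>) * indicator (log_box R) x \<partial>lebesgue)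
      = (\<integral>\<^sup>+ x. ennreal (1 / \<bar>fst x * snd x\<bar>) * indicator (log_box R) x \<partial>(lborel :: (real \<times> real) measure))"
    by (subst nn_integral_completion) auto
  also have "\<dots> = (\<integral>\<^sup>+ x. ?g (fst x) * ?g (snd x) \<partial>(lborel \<Otimes>\<^sub>M lborel))"
    unfolding lborel_prod
    by (intro nn_integral_cong)
       (auto simp: log_box_def indicator_def abs_mult simp flip: ennreal_mult)
  also have "\<dots> = (\<integral>\<^sup>+ x. \<integral>\<^sup>+ y. ?g x * ?g y \<partial>lborel \<partial>lborel)"
    by (subst lborel.nn_integral_fst[symmetric]) auto
  also have "\<dots> = (\<integral>\<^sup>+ x. ?g x * ennreal (4 * ln R) \<partial>lborel)"
    by (subst nn_integral_cmult) (auto simp: nn_integral_symmetric_log_interval[OF assms])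
  also have "\<dots> = ennreal (4 * ln R) * ennreal (4 * ln R)"
    by (subst nn_integral_multc) (auto simp: nn_integral_symmetric_log_interval[OF assms])
  also have "\<dots> = ennreal ((4 * ln R)\<^sup>2)"
    using assms by (simp add: power2_eq_square flip: ennreal_mult)
  finally show ?thesis .
qed

section \<open>Null sets: the axes and coordinatewise division\<close>

lemma AE_lebesgue_nonzero_coordinates:
  "AE t in (lebesgue :: (real \<times> real) measure). fst t \<noteq> 0 \<and> snd t \<noteq> 0"
proof -
  have "negligible {t :: real \<times> real. (1, 0) \<bullet> t = 0}" "negligible {t :: real \<times> real. (0, 1) \<bullet> t = 0}"
    by (intro negligible_hyperplane; simp add: zero_prod_def)+
  then have "negligible ({t :: real \<times> real. fst t = 0} \<union> {t. snd t = 0})"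
    by (intro negligible_Un) (simp_all add: inner_prod_def)
  then show ?thesis
    unfolding negligible_iff_null_sets by (rule AE_I') auto
qed

text \<open>The weight is controlled only almost everywhere, but it is evaluated at \<open>x / t\<close>, where \<open>x\<close> is
  fixed and \<open>t\<close> varies. Exceptional sets pull back to null sets because, off the axes,
  \<open>t \<mapsto> x / t\<close> is a differentiable involution.\<close>

lemma AE_lebesgue_coordinate_quotient:
  fixes x :: "real \<times> real"
  assumes "fst x \<noteq> 0" "snd x \<noteq> 0" "AE y in lebesgue. P y"
  shows "AE t in lebesgue. P (fst x / fst t, snd x / snd t)"
proof -
  define q where "q y = (fst x / fst y, snd x / snd y)" for y :: "real \<times> real"
  obtain N where N: "N \<in> null_sets lebesgue" "{y. \<not> P y} \<subseteq> N"
    using assms(3) by (auto simp: eventually_ae_filter)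
  define N' where "N' = N \<inter> {y. fst y \<noteq> 0 \<and> snd y \<noteq> 0}"
  have "negligible N'"
    using N(1) unfolding N'_def negligible_iff_null_sets[symmetric]
    by (rule negligible_subset) auto
  moreover have "q differentiable_on N'"
    unfolding q_def N'_def differentiable_on_def
    by (auto intro!: derivative_eq_intros simp: differentiable_def)
  ultimately have "negligible (q ` N')"
    by (intro negligible_differentiable_image_negligible) auto
  then have "AE t in lebesgue. t \<notin> q ` N'"
    unfolding negligible_iff_null_sets by (rule AE_not_in)
  with AE_lebesgue_nonzero_coordinates show ?thesis
  proof eventually_elim
    case (elim t)
    have "t = q (q t)" using assms elim by (cases t) (auto simp: q_def)
    moreover have "q t \<in> {y. fst y \<noteq> 0 \<and> snd y \<noteq> 0}" using assms elim by (auto simp: q_def)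
    ultimately have "q t \<notin> N" using elim by (auto simp: N'_def)
    then show ?case using N(2) by (auto simp: q_def)
  qed
qed

text \<open>The boxes increase to the complement of the two axes, which are null. The shift by \<open>2\<close>
  makes every radius larger than \<open>1\<close>, so that the powers of the radius tend to infinity.\<close>

lemma nn_integral_log_box_exhaustion:
  fixes h :: "real \<times> real \<Rightarrow> ennreal"
  assumes [measurable]: "h \<in> borel_measurable lebesgue"
  shows "(\<integral>\<^sup>+ t. h t \<partial>lebesgue)
    = (SUP n. \<integral>\<^sup>+ t. h t * indicator (log_box (real n + 2)) t \<partial>lebesgue)"
proof -
  let ?B = "\<lambda>n. log_box (real n + 2)"
  have mono: "?B m \<subseteq> ?B n" if "m \<le> n" for m n
  proof -
    have "1 / (real n + 2) \<le> 1 / (real m + 2)" using that by (intro frac_le) auto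
    then show ?thesis using that by (auto simp: log_box_def)
  qed
  have "(SUP n. h t * indicator (?B n) t) = h t" if t: "fst t \<noteq> 0" "snd t \<noteq> 0" for t
  proof -
    obtain n where n: "max (max \<bar>fst t\<bar> \<bar>snd t\<bar>) (max (1 / \<bar>fst t\<bar>) (1 / \<bar>snd t\<bar>)) \<le> real n"
      using real_arch_simple by blast
    have "1 / (real n + 2) \<le> \<bar>a\<bar>" if "1 / \<bar>a\<bar> \<le> real n" "a \<noteq> 0" for a
      using that by (simp add: field_simps)
    with n t have "t \<in> ?B n" by (auto simp: log_box_def)
    then have "h t \<le> (SUP n. h t * indicator (?B n) t)"
      by (intro SUP_upper2[of n]) auto
    moreover have "(SUP n. h t * indicator (?B n) t) \<le> h t"
      by (rule SUP_least) (simp add: indicator_def)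
    ultimately show ?thesis by (rule antisym[rotated])
  qed
  then have "AE t in lebesgue. h t = (SUP n. h t * indicator (?B n) t)"
    using AE_lebesgue_nonzero_coordinates by (auto elim: AE_mp)
  then have "(\<integral>\<^sup>+ t. h t \<partial>lebesgue) = (\<integral>\<^sup>+ t. (SUP n. h t * indicator (?B n) t) \<partial>lebesgue)"
    by (rule nn_integral_cong_AE)
  also have "\<dots> = (SUP n. \<integral>\<^sup>+ t. h t * indicator (?B n) t \<partial>lebesgue)"
    using mono
    by (intro nn_integral_monotone_convergence_SUP) (auto simp: incseq_def le_fun_def indicator_def)
  finally show ?thesis .
qed

section \<open>The test functions\<close>

text \<open>The factor \<open>v powr (-1/p)\<close> cancels the weight in the norm, and \<open>\<bar>x\<^sub>1 x\<^sub>2\<bar> powr (-1/p)\<close> turns Lebesgue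
  measure into Haar measure. Where \<open>v\<close> is \<open>0\<close> or \<open>\<infinity>\<close> the value is \<open>0\<close>, as \<^const>\<open>enn2real\<close>
  is \<open>0\<close> there and so are its powers.\<close>

definition test_function ::
    "real \<Rightarrow> (real \<times> real \<Rightarrow> ennreal) \<Rightarrow> real \<Rightarrow> real \<times> real \<Rightarrow> 'a::real_normed_field" where
  "test_function p v R x = of_real (indicator (log_box R) x *
     (\<bar>fst x * snd x\<bar> powr (- (1 / p)) * enn2real (v x) powr (- (1 / p))))"

lemma norm_test_function:
  "norm (test_function p v R x :: 'a::real_normed_field) = indicator (log_box R) x *
     (\<bar>fst x * snd x\<bar> powr (- (1 / p)) * enn2real (v x) powr (- (1 / p)))"
  unfolding test_function_def norm_of_real by simp

lemma inverse_root_powr: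
  fixes a b :: real
  assumes "0 < p" "0 < a" "0 < b"
  shows "(a powr (- (1 / p)) * b powr (- (1 / p))) powr p = 1 / (a * b)"
proof -
  have "(a powr (- (1 / p)) * b powr (- (1 / p))) powr p = a powr (- 1) * b powr (- 1)"
    using assms by (simp add: powr_mult powr_powr)
  then show ?thesis using assms by (simp add: powr_minus_divide)
qed

lemma test_function_measurable:
  fixes v :: "real \<times> real \<Rightarrow> ennreal"
  assumes "v \<in> borel_measurable lebesgue"
  shows "(test_function p v R :: real \<times> real \<Rightarrow> 'a::real_normed_field) \<in> borel_measurable lebesgue"
proof -
  note assms [measurable]
  have "(\<lambda>x. indicator (log_box R) x *
     (\<bar>fst x * snd x\<bar> powr (- (1 / p)) * enn2real (v x) powr (- (1 / p)))) \<in> borel_measurable lebesgue"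
    by measurable
  then show ?thesis
    unfolding test_function_def
    by (rule measurable_compose) (intro borel_measurable_continuous_onI continuous_intros)
qed

lemma weighted_integral_test_function:
  assumes "0 < p" "1 \<le> R" "weight_function v"
  shows "weighted_integral p v (test_function p v R :: _ \<Rightarrow> 'a::real_normed_field)
    = ennreal ((4 * ln R)\<^sup>2)"
proof -
  have "AE x in lebesgue. 0 < v x \<and> v x < \<infinity>"
    using assms(3) by (simp add: weight_function_def)
  then have "AE x in lebesgue. ennreal (norm (test_function p v R x :: 'a) powr p) * v x
      = ennreal (1 / \<bar>fst x * snd x\<bar>) * indicator (log_box R) x"
  proof eventually_elim
    case (elim x)
    then obtain b where b: "v x = ennreal b" "0 < b"
      by (cases "v x") auto
    show ?case
    proof (cases "x \<in> log_box R")
      case True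
      then have "0 < \<bar>fst x * snd x\<bar>"
        using log_box_nonzero[OF assms(2)] by simp
      with True b assms(1) show ?thesis
        by (simp add: norm_test_function inverse_root_powr flip: ennreal_mult)
    qed (simp add: norm_test_function)
  qed
  then show ?thesis
    unfolding weighted_integral_def nn_integral_log_box[OF assms(2), symmetric]
    by (rule nn_integral_cong_AE)
qed

lemma test_function_in_Lp_space:
  assumes "0 < p" "1 \<le> R" "weight_function v"
  shows "(test_function p v R :: _ \<Rightarrow> 'a::real_normed_field) \<in> Lp_space p v"
  using assms weighted_integral_test_function[OF assms, where 'a='a]
  by (auto simp: Lp_space_def weight_function_def intro: test_function_measurable)

section \<open>Lower bounds for the operator on test functions\<close>

text \<open>One point \<open>y\<close> at which both \<open>v y\<close> and \<open>v (t y)\<close> are positive reals already makes the infimum finite,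
  so the infinite value of \<^const>\<open>ennreal_powr\<close> does not occur for such \<open>t\<close>.\<close>

lemma weight_ratio_inf_powr_le:
  assumes "0 < p" "0 < a" "0 < b" "v x = ennreal a" "v (fst x / fst t, snd x / snd t) = ennreal b"
    and "fst t \<noteq> 0" "snd t \<noteq> 0"
  shows "ennreal_powr (weight_ratio_inf v t) (1 / p) \<le> ennreal ((a / b) powr (1 / p))"
proof -
  have "weight_ratio_inf v t \<le> v x / v (fst x / fst t, snd x / snd t)"
    unfolding weight_ratio_inf_def
    by (rule INF_lower2[of "(fst x / fst t, snd x / snd t)"]) (use assms in auto)
  then have le: "weight_ratio_inf v t \<le> ennreal (a / b)"
    using assms by (simp add: divide_ennreal)
  then obtain r where r: "weight_ratio_inf v t = ennreal r" "0 \<le> r"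
    by (metis ennreal_cases ennreal_neq_top top.extremum_uniqueI)
  with le have "r \<le> a / b" using assms by simp
  then show ?thesis
    using r assms by (auto simp: ennreal_powr_def intro!: ennreal_leI powr_mono2)
qed

text \<open>With \<open>y = x / t\<close> the test function contributes \<open>(\<bar>x\<^sub>1 x\<^sub>2\<bar> / \<bar>t\<^sub>1 t\<^sub>2\<bar>) powr (-1/p) * v y powr (-1/p)\<close>.
  Its power of \<open>\<bar>t\<^sub>1 t\<^sub>2\<bar>\<close> accounts for the \<open>-1/p\<close> in the exponent of \<^const>\<open>A_inf\<close>, and
  \<open>v y powr (-1/p) = (v x / v y) powr (1/p) * v x powr (-1/p)\<close> brings in the ratio of weights, to
  which the infimum is a lower bound.\<close>

lemma dunkl_hausdorff_kernel_lower_bound: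
  fixes x t :: "real \<times> real"
  assumes "0 < p" "1 \<le> R" "1 \<le> M" "x \<in> log_box M" "t \<in> log_box R"
    and "0 < v x" "v x < \<infinity>"
    and "0 < v (fst x / fst t, snd x / snd t)" "v (fst x / fst t, snd x / snd t) < \<infinity>"
  shows "ennreal (norm (\<phi> t) / \<bar>fst t * snd t\<bar> powr (2 * \<alpha> + 2 - 1 / p))
      * ennreal_powr (weight_ratio_inf v t) (1 / p)
      * ennreal (\<bar>fst x * snd x\<bar> powr (- (1 / p)) * enn2real (v x) powr (- (1 / p)))
    \<le> ennreal (norm (dunkl_hausdorff_integrand \<alpha> \<phi> (test_function p v (R * M)) x t :: 'a::real_normed_field))"
proof -
  define y where "y = (fst x / fst t, snd x / snd t)"
  define X where "X = \<bar>fst x * snd x\<bar>"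
  define T where "T = \<bar>fst t * snd t\<bar>"
  have t: "fst t \<noteq> 0" "snd t \<noteq> 0" and "fst x \<noteq> 0" "snd x \<noteq> 0"
    using log_box_nonzero assms(2-5) by blast+
  then have pos: "0 < X" "0 < T" by (simp_all add: X_def T_def)
  obtain a where a: "v x = ennreal a" "0 < a" using assms(6,7) by (cases "v x") auto
  obtain b where b: "v y = ennreal b" "0 < b" using assms(8,9) unfolding y_def by (cases "v y") (auto simp: y_def)
  have y: "y \<in> log_box (R * M)"
    unfolding y_def using assms by (intro log_box_divide) auto
  have Xy: "\<bar>fst y * snd y\<bar> = X / T" by (simp add: y_def X_def T_def abs_mult)
  have "ennreal (norm (\<phi> t) / T powr (2 * \<alpha> + 2 - 1 / p))
      * ennreal_powr (weight_ratio_inf v t) (1 / p)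
      * ennreal (X powr (- (1 / p)) * a powr (- (1 / p)))
    \<le> ennreal (norm (\<phi> t) / T powr (2 * \<alpha> + 2 - 1 / p)) * ennreal ((a / b) powr (1 / p))
      * ennreal (X powr (- (1 / p)) * a powr (- (1 / p)))"
    using weight_ratio_inf_powr_le[OF assms(1) a(2) b(2) a(1) b(1)[unfolded y_def] t]
    by (intro mult_right_mono mult_left_mono) auto
  also have "\<dots> = ennreal (norm (\<phi> t) / T powr (2 * \<alpha> + 2 - 1 / p) * (a / b) powr (1 / p)
      * (X powr (- (1 / p)) * a powr (- (1 / p))))"
    by (simp flip: ennreal_mult)
  also have "norm (\<phi> t) / T powr (2 * \<alpha> + 2 - 1 / p) * (a / b) powr (1 / p)
      * (X powr (- (1 / p)) * a powr (- (1 / p)))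
    = norm (\<phi> t) / T powr (2 * \<alpha> + 2) * ((X / T) powr (- (1 / p)) * b powr (- (1 / p)))"
    using pos a(2) b(2) by (simp add: powr_divide powr_diff powr_minus field_simps)
  also have "\<dots> = norm (dunkl_hausdorff_integrand \<alpha> \<phi> (test_function p v (R * M)) x t :: 'a)"
    using y b by (simp add: dunkl_hausdorff_integrand_def norm_test_function T_def Xy flip: y_def)
  finally show ?thesis using a by (simp add: X_def T_def)
qed

text \<open>Integrates the bound on the kernel over \<open>t\<close>. The integrand is a nonnegative real multiple of \<open>1\<close>, so
  the norm of the integral is the integral of the norm. The point \<open>x\<close> must be one where the
  Bochner integral exists, as otherwise its value \<open>0\<close> by convention would break the bound.\<close>

lemma dunkl_hausdorff_test_function_lower_bound:
  fixes \<phi> :: "real \<times> real \<Rightarrow> 'a::{real_normed_field, banach, second_countable_topology}"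
  assumes "0 < p" "1 \<le> R" "1 \<le> M" "x \<in> log_box M" "0 < v x" "v x < \<infinity>"
    and v: "AE y in lebesgue. 0 < v y \<and> v y < \<infinity>"
    and int: "integrable lebesgue (dunkl_hausdorff_integrand \<alpha> \<phi> (test_function p v (R * M)) x)"
    and h [measurable]: "h \<in> borel_measurable lebesgue"
    and h_le: "\<And>t. h t \<le> ennreal (norm (\<phi> t) / \<bar>fst t * snd t\<bar> powr (2 * \<alpha> + 2 - 1 / p))
            * ennreal_powr (weight_ratio_inf v t) (1 / p)"
    and h0: "\<And>t. t \<notin> log_box R \<Longrightarrow> h t = 0"
    and c: "0 \<le> c" "ennreal c \<le> (\<integral>\<^sup>+ t. h t \<partial>lebesgue)"
  shows "c * (\<bar>fst x * snd x\<bar> powr (- (1 / p)) * enn2real (v x) powr (- (1 / p)))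
    \<le> norm (dunkl_hausdorff \<alpha> \<phi> (test_function p v (R * M)) x)"
proof -
  let ?F = "dunkl_hausdorff_integrand \<alpha> \<phi> (test_function p v (R * M)) x"
  define s where "s = \<bar>fst x * snd x\<bar> powr (- (1 / p)) * enn2real (v x) powr (- (1 / p))"
  have "0 \<le> s" by (simp add: s_def)
  have x: "fst x \<noteq> 0" "snd x \<noteq> 0"
    using log_box_nonzero assms(3,4) by blast+
  have "ennreal (c * s) \<le> (\<integral>\<^sup>+ t. h t \<partial>lebesgue) * ennreal s"
    using c \<open>0 \<le> s\<close> by (simp add: ennreal_mult mult_right_mono)
  also have "\<dots> = (\<integral>\<^sup>+ t. h t * ennreal s \<partial>lebesgue)"
    by (simp add: nn_integral_multc)
  also have "\<dots> \<le> (\<integral>\<^sup>+ t. ennreal (norm (?F t)) \<partial>lebesgue)"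
  proof (rule nn_integral_mono_AE)
    show "AE t in lebesgue. h t * ennreal s \<le> ennreal (norm (?F t))"
      using AE_lebesgue_coordinate_quotient[OF x v]
    proof eventually_elim
      case (elim t)
      show ?case
      proof (cases "t \<in> log_box R")
        case True
        have "h t * ennreal s \<le> ennreal (norm (\<phi> t) / \<bar>fst t * snd t\<bar> powr (2 * \<alpha> + 2 - 1 / p))
            * ennreal_powr (weight_ratio_inf v t) (1 / p) * ennreal s"
          by (intro mult_right_mono h_le) auto
        also have "\<dots> \<le> ennreal (norm (?F t))"
          unfolding s_def
          using dunkl_hausdorff_kernel_lower_bound[where v=v] assms(1-6) True elim by blast
        finally show ?thesis .
      qed (simp add: h0)
    qed
  qed
  also have "\<dots> = ennreal (\<integral> t. norm (?F t) \<partial>lebesgue)"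
    using int by (intro nn_integral_eq_integral) auto
  finally have le: "c * s \<le> (\<integral> t. norm (?F t) \<partial>lebesgue)"
    by simp
  have F: "?F t = of_real (norm (?F t))" for t
  proof -
    have "?F t = of_real (norm (\<phi> t) / \<bar>fst t * snd t\<bar> powr (2 * \<alpha> + 2) *
        (indicator (log_box (R * M)) (fst x / fst t, snd x / snd t) *
          (\<bar>fst x / fst t * (snd x / snd t)\<bar> powr (- (1 / p))
            * enn2real (v (fst x / fst t, snd x / snd t)) powr (- (1 / p)))))" (is "_ = of_real ?k")
      by (simp add: dunkl_hausdorff_integrand_def test_function_def scaleR_conv_of_real)
    moreover have "0 \<le> ?k" by simp
    ultimately show ?thesis by (metis abs_of_nonneg norm_of_real)
  qed
  have "dunkl_hausdorff \<alpha> \<phi> (test_function p v (R * M)) x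
      = (\<integral> t. of_real (norm (?F t)) \<partial>lebesgue)"
    unfolding dunkl_hausdorff_def by (rule Bochner_Integration.integral_cong[OF refl F])
  also have "\<dots> = of_real (\<integral> t. norm (?F t) \<partial>lebesgue)"
    using int by (intro integral_of_real integrable_norm)
  finally have "dunkl_hausdorff \<alpha> \<phi> (test_function p v (R * M)) x
      = of_real (\<integral> t. norm (?F t) \<partial>lebesgue)" .
  then have "norm (dunkl_hausdorff \<alpha> \<phi> (test_function p v (R * M)) x) = (\<integral> t. norm (?F t) \<partial>lebesgue)"
    by (simp add: integral_nonneg_AE)
  with le show ?thesis by (simp add: s_def)
qed

text \<open>Let \<open>f\<close> be the test function on \<open>log_box (R * M)\<close>. The integral of \<open>norm (H f x) powr p * v x\<close>
  lies between the two sides: it is at least its part over the smaller box \<open>log_box M\<close>, where the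
  pointwise bound applies, and at most \<open>C powr p\<close> times the same integral for \<open>f\<close>, which is known
  exactly.\<close>

lemma dunkl_hausdorff_log_box_inequality:
  fixes \<phi> :: "real \<times> real \<Rightarrow> 'a::{real_normed_field, banach, second_countable_topology}"
  assumes p: "0 < p" and R: "1 \<le> R" and M: "1 \<le> M" and v: "weight_function v"
    and def_on: "dunkl_hausdorff_defined_on \<alpha> \<phi> (Lp_space p v)"
    and maps: "\<And>f. f \<in> Lp_space p v \<Longrightarrow> dunkl_hausdorff \<alpha> \<phi> f \<in> Lp_space p v"
    and C: "C \<in> operator_bounds p v (dunkl_hausdorff \<alpha> \<phi>)"
    and h: "h \<in> borel_measurable lebesgue"
    and h_le: "\<And>t. h t \<le> ennreal (norm (\<phi> t) / \<bar>fst t * snd t\<bar> powr (2 * \<alpha> + 2 - 1 / p))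
            * ennreal_powr (weight_ratio_inf v t) (1 / p)"
    and h0: "\<And>t. t \<notin> log_box R \<Longrightarrow> h t = 0"
    and c: "0 \<le> c" "ennreal c \<le> (\<integral>\<^sup>+ t. h t \<partial>lebesgue)"
  shows "c powr p * (4 * ln M)\<^sup>2 \<le> C powr p * (4 * ln (R * M))\<^sup>2"
proof -
  define f :: "real \<times> real \<Rightarrow> 'a" where "f = test_function p v (R * M)"
  define w where "w = enn2real (weighted_integral p v (dunkl_hausdorff \<alpha> \<phi> f))"
  have RM: "1 \<le> R * M" using R M by (metis mult_mono' mult_1 zero_le_one)
  have v': "AE y in lebesgue. 0 < v y \<and> v y < \<infinity>"
    using v by (simp add: weight_function_def)
  have f: "f \<in> Lp_space p v"
    unfolding f_def by (rule test_function_in_Lp_space[OF p RM v])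
  have "AE x in lebesgue. integrable lebesgue (dunkl_hausdorff_integrand \<alpha> \<phi> f x)"
    using def_on f by (simp add: dunkl_hausdorff_defined_on_def)
  with v' have "AE x in lebesgue.
      ennreal (c powr p) * (ennreal (1 / \<bar>fst x * snd x\<bar>) * indicator (log_box M) x)
        \<le> ennreal (norm (dunkl_hausdorff \<alpha> \<phi> f x) powr p) * v x"
  proof eventually_elim
    case (elim x)
    show ?case
    proof (cases "x \<in> log_box M")
      case True
      obtain a where a: "v x = ennreal a" "0 < a" using elim by (cases "v x") auto
      have X: "0 < \<bar>fst x * snd x\<bar>" using log_box_nonzero[OF M True] by simp
      have "c * (\<bar>fst x * snd x\<bar> powr (- (1 / p)) * a powr (- (1 / p)))
          \<le> norm (dunkl_hausdorff \<alpha> \<phi> f x)"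
        using dunkl_hausdorff_test_function_lower_bound[OF p R M True _ _ v' _ h h_le h0 c] elim a
        by (simp add: f_def)
      then have "(c * (\<bar>fst x * snd x\<bar> powr (- (1 / p)) * a powr (- (1 / p)))) powr p
          \<le> norm (dunkl_hausdorff \<alpha> \<phi> f x) powr p"
        using p c by (intro powr_mono2) auto
      then have "c powr p * (1 / (\<bar>fst x * snd x\<bar> * a)) \<le> norm (dunkl_hausdorff \<alpha> \<phi> f x) powr p"
        using inverse_root_powr[OF p X a(2)] c by (simp add: powr_mult)
      then have "c powr p * (1 / (\<bar>fst x * snd x\<bar> * a)) * a \<le> norm (dunkl_hausdorff \<alpha> \<phi> f x) powr p * a"
        using a by (intro mult_right_mono) auto
      then have "c powr p * (1 / \<bar>fst x * snd x\<bar>) \<le> norm (dunkl_hausdorff \<alpha> \<phi> f x) powr p * a"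
        using a by simp
      then have "ennreal (c powr p * (1 / \<bar>fst x * snd x\<bar>))
          \<le> ennreal (norm (dunkl_hausdorff \<alpha> \<phi> f x) powr p * a)"
        by (rule ennreal_leI)
      then show ?thesis
        using a True by (simp flip: ennreal_mult)
    qed simp
  qed
  then have "(\<integral>\<^sup>+ x. ennreal (c powr p) *
        (ennreal (1 / \<bar>fst x * snd x\<bar>) * indicator (log_box M) x) \<partial>lebesgue)
      \<le> weighted_integral p v (dunkl_hausdorff \<alpha> \<phi> f)"
    unfolding weighted_integral_def by (rule nn_integral_mono_AE)
  also have "(\<integral>\<^sup>+ x. ennreal (c powr p) *
        (ennreal (1 / \<bar>fst x * snd x\<bar>) * indicator (log_box M) x) \<partial>lebesgue)
      = ennreal (c powr p) * ennreal ((4 * ln M)\<^sup>2)"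
    unfolding nn_integral_log_box[OF M, symmetric]
    by (rule nn_integral_cmult) measurable
  also have "weighted_integral p v (dunkl_hausdorff \<alpha> \<phi> f) = ennreal w"
    using maps[OF f] by (simp add: w_def Lp_space_def less_top)
  finally have "c powr p * (4 * ln M)\<^sup>2 \<le> w"
    by (simp add: w_def flip: ennreal_mult)
  also have "w \<le> C powr p * (4 * ln (R * M))\<^sup>2"
  proof -
    have "0 \<le> C" and "Lp_norm p v (dunkl_hausdorff \<alpha> \<phi> f) \<le> C * Lp_norm p v f"
      using C f by (auto simp: operator_bounds_def)
    then have "w powr (1 / p) \<le> C * ((4 * ln (R * M))\<^sup>2) powr (1 / p)"
      using weighted_integral_test_function[OF p RM v, where 'a='a]
      by (simp add: Lp_norm_def w_def f_def)
    then have "(w powr (1 / p)) powr p \<le> (C * ((4 * ln (R * M))\<^sup>2) powr (1 / p)) powr p"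
      using p by (intro powr_mono2) auto
    then show ?thesis
      using p \<open>0 \<le> C\<close> by (simp add: powr_mult powr_powr w_def)
  qed
  finally show ?thesis .
qed

section \<open>Comparison with the operator norm\<close>

text \<open>For \<open>M = R ^ (n + 1)\<close> the logarithms are \<open>(n + 1) * ln R\<close> and \<open>(n + 2) * ln R\<close>, so dividing
  leaves the factor \<open>(1 + 1 / (n + 1))\<^sup>2\<close>, which tends to \<open>1\<close>.\<close>

lemma le_of_log_box_inequality:
  assumes "0 < p" "1 < R" "0 \<le> C"
    and "\<And>M. 1 \<le> M \<Longrightarrow> c powr p * (4 * ln M)\<^sup>2 \<le> C powr p * (4 * ln (R * M))\<^sup>2"
  shows "c \<le> (C :: real)"
proof -
  have "c powr p \<le> C powr p * (1 + 1 / real (Suc n))\<^sup>2" for n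
  proof -
    define k where "k = 4 * ln R"
    have k: "0 < k" using assms(2) by (simp add: k_def)
    have "4 * ln (R ^ Suc n) = real (Suc n) * k" "4 * ln (R * R ^ Suc n) = (real (Suc n) + 1) * k"
      using assms(2) by (simp_all add: ln_realpow ln_mult k_def algebra_simps)
    then have "c powr p * (real (Suc n) * k)\<^sup>2 \<le> C powr p * ((real (Suc n) + 1) * k)\<^sup>2"
      using assms(2) assms(4)[of "R ^ Suc n"] by (metis less_imp_le one_le_power)
    then have "k\<^sup>2 * (c powr p * (real (Suc n))\<^sup>2) \<le> k\<^sup>2 * (C powr p * (real (Suc n) + 1)\<^sup>2)"
      by (simp only: power_mult_distrib mult_ac)
    then have "c powr p * (real (Suc n))\<^sup>2 \<le> C powr p * (real (Suc n) + 1)\<^sup>2"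
      using k by (subst (asm) mult_le_cancel_left_pos) auto
    also have "real (Suc n) + 1 = (1 + 1 / real (Suc n)) * real (Suc n)"
      by (simp add: field_simps del: of_nat_Suc)
    finally show ?thesis
      by (simp add: power_mult_distrib del: of_nat_Suc flip: mult.assoc)
  qed
  moreover have "(\<lambda>n. C powr p * (1 + 1 / real (Suc n))\<^sup>2) \<longlonglongrightarrow> C powr p * (1 + 0)\<^sup>2"
    using lim_inverse_n' by (intro tendsto_intros LIMSEQ_Suc)
  ultimately have "c powr p \<le> C powr p"
    by (intro LIMSEQ_le_const[where X="\<lambda>n. C powr p * (1 + 1 / real (Suc n))\<^sup>2"]) auto
  then show ?thesis
    using assms(1,3) by (meson linorder_not_less powr_less_mono2)
qed

text \<open>The integrand of \<^const>\<open>A_inf\<close> need not be measurable, but its integral is by definition a supremum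
  over simple functions \<open>g\<close> below it, and these are measurable. If the claim failed, some
  truncation \<open>h\<close> of such a \<open>g\<close> to a box would already have an integral above \<open>C\<close>. A real number
  \<open>c\<close> strictly in between takes the place of this integral, which might be infinite.\<close>

lemma A_inf_le_operator_bound:
  fixes \<phi> :: "real \<times> real \<Rightarrow> 'a::{real_normed_field, banach, second_countable_topology}"
  assumes p: "0 < p" and v: "weight_function v"
    and def_on: "dunkl_hausdorff_defined_on \<alpha> \<phi> (Lp_space p v)"
    and maps: "\<And>f. f \<in> Lp_space p v \<Longrightarrow> dunkl_hausdorff \<alpha> \<phi> f \<in> Lp_space p v"
    and C: "C \<in> operator_bounds p v (dunkl_hausdorff \<alpha> \<phi>)"
  shows "A_inf p \<alpha> v \<phi> \<le> ennreal C"
proof (rule ccontr)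
  assume "\<not> ?thesis"
  then obtain g where g: "simple_function lebesgue g"
      "\<And>t. g t \<le> ennreal (norm (\<phi> t) / \<bar>fst t * snd t\<bar> powr (2 * \<alpha> + 2 - 1 / p))
            * ennreal_powr (weight_ratio_inf v t) (1 / p)"
      "ennreal C < integral\<^sup>S lebesgue g"
    unfolding A_inf_def nn_integral_def by (auto simp: not_le less_SUP_iff le_fun_def)
  have g_meas [measurable]: "g \<in> borel_measurable lebesgue"
    using g(1) by (rule borel_measurable_simple_function)
  obtain n where n: "ennreal C < (\<integral>\<^sup>+ t. g t * indicator (log_box (real n + 2)) t \<partial>lebesgue)"
    using g(3) nn_integral_log_box_exhaustion[OF g_meas]
    by (auto simp: nn_integral_eq_simple_integral[OF g(1)] less_SUP_iff)
  define R where "R = real n + 2"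
  define h where "h t = g t * indicator (log_box R) t" for t
  obtain z where z: "ennreal C < z" "z < (\<integral>\<^sup>+ t. h t \<partial>lebesgue)"
    using dense[OF n] by (auto simp: h_def R_def)
  then obtain c where c: "z = ennreal c" "0 \<le> c" by (cases z) auto
  have "0 \<le> C" using C by (simp add: operator_bounds_def)
  have h_meas: "h \<in> borel_measurable lebesgue" unfolding h_def by measurable
  have h_le: "h t \<le> ennreal (norm (\<phi> t) / \<bar>fst t * snd t\<bar> powr (2 * \<alpha> + 2 - 1 / p))
            * ennreal_powr (weight_ratio_inf v t) (1 / p)" for t
    using g(2)[of t] by (simp add: h_def indicator_def)
  have "c \<le> C"
  proof (rule le_of_log_box_inequality[OF p _ \<open>0 \<le> C\<close>])
    show "1 < R" by (simp add: R_def)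
    show "c powr p * (4 * ln M)\<^sup>2 \<le> C powr p * (4 * ln (R * M))\<^sup>2" if "1 \<le> M" for M
    proof (rule dunkl_hausdorff_log_box_inequality[OF p _ that v def_on maps C h_meas h_le])
      show "h t = 0" if "t \<notin> log_box R" for t using that by (simp add: h_def)
      show "ennreal c \<le> (\<integral>\<^sup>+ t. h t \<partial>lebesgue)" using z(2) c(1) by simp
    qed (use c in \<open>auto simp: R_def\<close>)
  qed
  with z(1) c show False using ennreal_leI by (auto simp: not_less[symmetric])
qed

theorem theorem3p3:
  fixes p \<alpha> :: real
    and v :: "real \<times> real \<Rightarrow> ennreal"
    and \<phi> :: "real \<times> real \<Rightarrow> 'a::{real_normed_field, banach, second_countable_topology}"
  assumes "1 < p"
    and "weight_function v"
    and "integrable lebesgue \<phi>"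
    and "dunkl_hausdorff_defined_on \<alpha> \<phi> (Lp_space p v)"
    and "bounded_operator p v (dunkl_hausdorff \<alpha> \<phi>)"
  shows "ennreal (operator_norm p v (dunkl_hausdorff \<alpha> \<phi>)) \<ge> A_inf p \<alpha> v \<phi>"
proof -
  let ?B = "operator_bounds p v (dunkl_hausdorff \<alpha> \<phi>)"
  have le: "A_inf p \<alpha> v \<phi> \<le> ennreal C" if "C \<in> ?B" for C
    using assms that by (intro A_inf_le_operator_bound) (auto simp: bounded_operator_def)
  have "?B \<noteq> {}" using assms(5) by (simp add: bounded_operator_def)
  then obtain C where "C \<in> ?B" by blast
  with le have "A_inf p \<alpha> v \<phi> \<le> ennreal C" by blast
  \<comment> \<open>Finiteness is needed first: the infimum of the bounds is taken among real numbers.\<close>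
  then obtain r where r: "A_inf p \<alpha> v \<phi> = ennreal r" "0 \<le> r"
    by (metis ennreal_cases ennreal_neq_top top.extremum_uniqueI)
  have "r \<le> C" if "C \<in> ?B" for C
    using le[OF that] that r by (auto simp: operator_bounds_def)
  then have "r \<le> operator_norm p v (dunkl_hausdorff \<alpha> \<phi>)"
    unfolding operator_norm_def by (intro cInf_greatest[OF \<open>?B \<noteq> {}\<close>])
  then show ?thesis unfolding r by (rule ennreal_leI)
qed

end
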